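(* $w\mathfrak{S}\le\mathfrak{r}$.
   Context: A partition of $\omega$ is a set of pairwise disjoint nonempty subsets of $\omega$ (blocks) with union $\omega$. $(\omega)^\omega$ is the set of partitions with infinitely many blocks, $(\omega)^\omega_\infty$ those with at least one infinite block. $X\sqsubseteq Y$ means every block of $X$ is a union of blocks of $Y$; $X\sqcup Y$ is the finest partition coarser than both. For finite $f\subseteq\omega$, $X\sqcup\{f\}$ is the finest partition coarser than $X$ with $f$ inside one block; $X\sqsubseteq^*Y$ iff $X\sqcup\{f\}\sqsubseteq Y$ for some finite $f$; $X\approx Y$ iff both directions hold; $X$ is trivial if $X\approx$ the partition into singletons. $X_1,X_2\in(\omega)^\omega$ are compatible if $X_1\sqcup X_2\in(\omega)^\omega$, orthogonal ($X_1\perp X_2$) if $X_1\sqcup X_2$ has the single block $\omega$. $X_1$ splits $X_2$ if they are compatible and some $Y\in(\omega)^\omega$ with $Y\sqsubseteq X_2$ satisfies $X_1\perp Y$. For a non-trivial $X\in(\omega)^\omega$, enumerate its blocks $b_0,b_1,\dots$ in order of their least elements, each block ordered naturally, and define $X^\perp$: if $X\in(\omega)^\omega_\infty$, $n$ lies in the $i$-th block of $X^\perp$ iff $n$ is the $i$-th element of some block of $X$; otherwise $X^\perp$ is the partition whose blocks are the set of least elements of blocks of $X$ together with singletons of all other numbers. A family $\mathcal{W}\subseteq(\omega)^\omega_\infty$ is weak splitting if for every non-trivial $X\in(\omega)^\omega$ there is $W\in\mathcal{W}$ which splits $X$ or splits $X^\perp$; $w\mathfrak{S}$ is the least size of a weak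 splitting family. $\mathfrak{r}$ is the reaping number. *)

theory Defs
  imports "HOL-Library.Disjoint_Sets"
begin

unbundle cardinal_syntax

type_synonym part = "nat set set"

definition inf_parts :: "part set" where
  "inf_parts = {X. partition_on UNIV X \<and> infinite X}"

definition inf_block_parts :: "part set" where
  "inf_block_parts = {X \<in> inf_parts. \<exists>b\<in>X. infinite b}"

definition coarser :: "part \<Rightarrow> part \<Rightarrow> bool" (infix "\<sqsubseteq>" 50) where
  "X \<sqsubseteq> Y \<longleftrightarrow> (\<forall>b\<in>X. \<exists>B\<subseteq>Y. b = \<Union>B)"

definition is_finest :: "(part \<Rightarrow> bool) \<Rightarrow> part \<Rightarrow> bool" where
  "is_finest P Z \<longleftrightarrow> partition_on UNIV Z \<and> P Z \<and>
     (\<forall>Z'. partition_on UNIV Z' \<and> P Z' \<longrightarrow> Z' \<sqsubseteq> Z)"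

definition pjoin :: "part \<Rightarrow> part \<Rightarrow> part" (infixl "\<squnion>" 65) where
  "X \<squnion> Y = (THE Z. is_finest (\<lambda>Z. Z \<sqsubseteq> X \<and> Z \<sqsubseteq> Y) Z)"

definition glue :: "part \<Rightarrow> nat set \<Rightarrow> part" where
  "glue X f = (THE Z. is_finest (\<lambda>Z. Z \<sqsubseteq> X \<and> (\<exists>b\<in>Z. f \<subseteq> b)) Z)"

definition almost_coarser :: "part \<Rightarrow> part \<Rightarrow> bool" (infix "\<sqsubseteq>\<^sup>*" 50) where
  "X \<sqsubseteq>\<^sup>* Y \<longleftrightarrow> (\<exists>f. finite f \<and> glue X f \<sqsubseteq> Y)"

definition almost_eq :: "part \<Rightarrow> part \<Rightarrow> bool" (infix "\<approx>" 50) where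
  "X \<approx> Y \<longleftrightarrow> X \<sqsubseteq>\<^sup>* Y \<and> Y \<sqsubseteq>\<^sup>* X"

definition trivial_part :: "part \<Rightarrow> bool" where
  "trivial_part X \<longleftrightarrow> X \<approx> range (\<lambda>n. {n})"

definition compatible :: "part \<Rightarrow> part \<Rightarrow> bool" where
  "compatible X Y \<longleftrightarrow> X \<squnion> Y \<in> inf_parts"

definition orthogonal :: "part \<Rightarrow> part \<Rightarrow> bool" where
  "orthogonal X Y \<longleftrightarrow> X \<squnion> Y = {UNIV}"

definition splits :: "part \<Rightarrow> part \<Rightarrow> bool" where
  "splits X Y \<longleftrightarrow> compatible X Y \<and> (\<exists>Z\<in>inf_parts. Z \<sqsubseteq> Y \<and> orthogonal X Z)"

text \<open>Elements of a block are numbered from 0, so \<open>n\<close> is the \<open>i\<close>-th element of \<open>b\<close> iff it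
  has exactly \<open>i\<close> predecessors in \<open>b\<close>; this covers finite and infinite blocks alike.\<close>

definition is_nth_elem :: "nat \<Rightarrow> nat set \<Rightarrow> nat \<Rightarrow> bool" where
  "is_nth_elem i b n \<longleftrightarrow> n \<in> b \<and> card {m \<in> b. m < n} = i"

definition perp :: "part \<Rightarrow> part" where
  "perp X =
     (if X \<in> inf_block_parts
      then range (\<lambda>i. {n. \<exists>b\<in>X. is_nth_elem i b n})
      else let M = (\<lambda>b. LEAST n. n \<in> b) ` X in insert M ((\<lambda>n. {n}) ` (- M)))"

definition weak_splitting :: "part set \<Rightarrow> bool" where
  "weak_splitting \<W> \<longleftrightarrow> \<W> \<subseteq> inf_block_parts \<and>
     (\<forall>X\<in>inf_parts. \<not> trivial_part X \<longrightarrow> (\<exists>W\<in>\<W>. splits W X \<or> splits W (perp X)))"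

text \<open>A set \<open>S\<close> splits \<open>A\<close> if \<open>A \<inter> S\<close> and \<open>A - S\<close> are both infinite; a family of infinite sets
  is reaping if no single set splits all of its members.\<close>

definition set_splits :: "nat set \<Rightarrow> nat set \<Rightarrow> bool" where
  "set_splits S A \<longleftrightarrow> infinite (A \<inter> S) \<and> infinite (A - S)"

definition reaping :: "nat set set \<Rightarrow> bool" where
  "reaping \<R> \<longleftrightarrow> (\<forall>A\<in>\<R>. infinite A) \<and> \<not> (\<exists>S. \<forall>A\<in>\<R>. set_splits S A)"

text \<open>The least cardinality of a set satisfying \<open>P\<close>, as a cardinal in the sense of the
  library; it is meaningful only if some set satisfies \<open>P\<close> (lemma \<open>least_size\<close>).\<close>

definition least_size :: "('a set \<Rightarrow> bool) \<Rightarrow> 'a rel" where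
  "least_size P = card_of (SOME A. P A \<and> (\<forall>B. P B \<longrightarrow> card_of A \<le>o card_of B))"

definition weak_splitting_number :: "part rel" where
  "weak_splitting_number = least_size weak_splitting"

definition reaping_number :: "nat set rel" where
  "reaping_number = least_size reaping"

lemma least_size:
  assumes "P A"
  shows "\<exists>A. P A \<and> least_size P = card_of A" and "P B \<Longrightarrow> least_size P \<le>o card_of B"
proof -
  have "\<exists>r\<in>card_of ` Collect P. \<forall>r'\<in>card_of ` Collect P. r \<le>o r'"
    using assms by (intro exists_minim_Card_order) (auto simp: card_of_Card_order)
  then have "\<exists>A. P A \<and> (\<forall>B. P B \<longrightarrow> card_of A \<le>o card_of B)" by blast
  from someI_ex[OF this] show "\<exists>A. P A \<and> least_size P = card_of A"
    and "P B \<Longrightarrow> least_size P \<le>o card_of B"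
    unfolding least_size_def by blast+
qed

lemma reaping_infinite_sets: "reaping (Collect infinite)"
proof -
  have "\<exists>A. infinite A \<and> \<not> set_splits S A" for S
  proof (cases "finite S")
    case True
    then show ?thesis by (intro exI[of _ UNIV]) (auto simp: set_splits_def)
  next
    case False
    then show ?thesis by (intro exI[of _ S]) (auto simp: set_splits_def)
  qed
  then show ?thesis unfolding reaping_def by blast
qed

text \<open>The remaining lemmas show that the descriptions defining \<open>pjoin\<close> and \<open>glue\<close> denote.\<close>

lemma coarser_iff:
  assumes X: "partition_on UNIV X" and Z: "partition_on UNIV Z"
  shows "Z \<sqsubseteq> X \<longleftrightarrow> (\<forall>b\<in>X. \<exists>c\<in>Z. b \<subseteq> c)"
proof
  assume L: "Z \<sqsubseteq> X"
  show "\<forall>b\<in>X. \<exists>c\<in>Z. b \<subseteq> c"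
  proof
    fix b assume b: "b \<in> X"
    then obtain n where n: "n \<in> b" using X unfolding partition_on_def by fastforce
    obtain c where c: "c \<in> Z" "n \<in> c" using Z unfolding partition_on_def by blast
    obtain B where B: "B \<subseteq> X" "c = \<Union>B" using L c unfolding coarser_def by blast
    then obtain b' where b': "b' \<in> B" "n \<in> b'" using c by blast
    then have "b' = b" using X B b n unfolding partition_on_def disjoint_def by blast
    then show "\<exists>c\<in>Z. b \<subseteq> c" using c B b' by blast
  qed
next
  assume R: "\<forall>b\<in>X. \<exists>c\<in>Z. b \<subseteq> c"
  show "Z \<sqsubseteq> X" unfolding coarser_def
  proof
    fix c assume c: "c \<in> Z"
    have "c = \<Union>{b\<in>X. b \<subseteq> c}"
    proof (intro equalityI subsetI)
      fix n assume n: "n \<in> c"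
      obtain b where b: "b \<in> X" "n \<in> b" using X unfolding partition_on_def by blast
      obtain c' where c': "c' \<in> Z" "b \<subseteq> c'" using R b by blast
      have "c' = c" using Z c c' b n unfolding partition_on_def disjoint_def by blast
      then show "n \<in> \<Union>{b\<in>X. b \<subseteq> c}" using b c' by blast
    qed blast
    then show "\<exists>B\<subseteq>X. c = \<Union>B" by (intro exI[of _ "{b\<in>X. b \<subseteq> c}"]) blast
  qed
qed

lemma coarser_antisym:
  assumes X: "partition_on UNIV X" and Y: "partition_on UNIV Y" and "X \<sqsubseteq> Y" "Y \<sqsubseteq> X"
  shows "X = Y"
proof -
  have *: "X \<subseteq> Y" if X: "partition_on UNIV X" and Y: "partition_on UNIV Y"
    and le: "X \<sqsubseteq> Y" "Y \<sqsubseteq> X" for X Y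
  proof
    fix b assume b: "b \<in> X"
    obtain c where c: "c \<in> Y" "b \<subseteq> c" using le(2) b coarser_iff[OF X Y] by blast
    obtain b' where b': "b' \<in> X" "c \<subseteq> b'" using le(1) c coarser_iff[OF Y X] by blast
    obtain n where n: "n \<in> b" using X b unfolding partition_on_def by fastforce
    have "n \<in> b'" using n c b' by blast
    then have "b' = b" using X b b' n unfolding partition_on_def disjoint_def by blast
    then have "b = c" using b' c by simp
    then show "b \<in> Y" using c by simp
  qed
  show ?thesis using *[OF X Y assms(3,4)] *[OF Y X assms(4,3)] by (rule equalityI)
qed

lemma finest_exists:
  assumes P: "\<And>Z. partition_on UNIV Z \<Longrightarrow> P Z \<longleftrightarrow> (\<forall>s\<in>C. \<exists>c\<in>Z. s \<subseteq> c)"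
  shows "\<exists>!Z. is_finest P Z"
proof -
  define r where "r = {(m, n). \<exists>s\<in>C. m \<in> s \<and> n \<in> s}"
  define Z where "Z = UNIV // r\<^sup>*"
  have "sym r" by (auto simp: r_def sym_def)
  then have "equiv UNIV (r\<^sup>*)"
    by (intro equivI) (auto intro: sym_rtrancl refl_rtrancl trans_rtrancl)
  then have Z: "partition_on UNIV Z" unfolding Z_def by (rule partition_on_quotient)
  have PZ: "P Z" unfolding P[OF Z]
  proof
    fix s assume s: "s \<in> C"
    obtain n where n: "s = {} \<or> n \<in> s" by blast
    have "s \<subseteq> r\<^sup>* `` {n}" using n s by (auto simp: r_def)
    then show "\<exists>c\<in>Z. s \<subseteq> c" unfolding Z_def by (meson UNIV_I quotientI)
  qed
  have "Z' \<sqsubseteq> Z" if Z': "partition_on UNIV Z'" and "P Z'" for Z'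
    unfolding coarser_iff[OF Z Z']
  proof
    fix b assume "b \<in> Z"
    then obtain n where b: "b = r\<^sup>* `` {n}" unfolding Z_def by (auto elim: quotientE)
    obtain c where c: "c \<in> Z'" "n \<in> c" using Z' unfolding partition_on_def by blast
    have "m \<in> c" if "(n, m) \<in> r\<^sup>*" for m using that
    proof induction
      case base
      show ?case by (rule c)
    next
      case (step y z)
      then obtain s where s: "s \<in> C" "y \<in> s" "z \<in> s" by (auto simp: r_def)
      obtain c' where "c' \<in> Z'" "s \<subseteq> c'" using \<open>P Z'\<close> s P[OF Z'] by blast
      moreover from this have "c' = c"
        using Z' c s step unfolding partition_on_def disjoint_def by blast
      ultimately show ?case using s by blast
    qed
    then show "\<exists>c\<in>Z'. b \<subseteq> c" using c b by blast
  qed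
  then have "is_finest P Z" using Z PZ by (simp add: is_finest_def)
  moreover have "Z1 = Z2" if "is_finest P Z1" "is_finest P Z2" for Z1 Z2
    using that coarser_antisym[of Z1 Z2] by (simp add: is_finest_def)
  ultimately show ?thesis by (intro ex1I[of _ Z])
qed

lemma pjoin_is_finest:
  assumes "partition_on UNIV X" "partition_on UNIV Y"
  shows "is_finest (\<lambda>Z. Z \<sqsubseteq> X \<and> Z \<sqsubseteq> Y) (X \<squnion> Y)"
  unfolding pjoin_def
  by (rule theI', rule finest_exists[of _ "X \<union> Y"])
    (simp only: coarser_iff[OF assms(1)] coarser_iff[OF assms(2)] ball_Un)

lemma glue_is_finest:
  assumes "partition_on UNIV X"
  shows "is_finest (\<lambda>Z. Z \<sqsubseteq> X \<and> (\<exists>b\<in>Z. f \<subseteq> b)) (glue X f)"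
  unfolding glue_def
  by (rule theI', rule finest_exists[of _ "insert f X"])
    (simp add: coarser_iff[OF assms] conj_commute)

end

theory Submission
  imports Defs "HOL-Library.Infinite_Set"
begin

text \<open>For \<open>A \<subseteq> \<omega>\<close> let \<open>W\<^sub>A\<close> have \<open>A\<close> as its only possibly non-singleton block. Then \<open>W\<^sub>A\<close> splits
  \<open>X\<close> as soon as \<open>A\<close> meets infinitely many and misses infinitely many blocks of \<open>X\<close>. Blocks of
  \<open>X\<close> meet blocks of \<open>X\<^sup>\<bottom>\<close> in finite sets, so an infinite \<open>A\<close> meets infinitely many blocks of \<open>X\<close>
  or of \<open>X\<^sup>\<bottom>\<close>. It remains to miss infinitely many blocks of both. Given a reaping family \<open>\<R>\<close>, pick
  \<open>A \<in> \<R>\<close> not split by a union of blocks of \<open>X\<close> that omits infinitely many blocks, and then, inside \<open>A\<close>,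
  the image of some \<open>B \<in> \<R>\<close> under the enumeration of \<open>A\<close>, to treat \<open>X\<^sup>\<bottom>\<close> in the same way. Since \<open>\<R>\<close>
  is infinite, there are only \<open>\<bar>\<R> \<times> \<R>\<bar> = \<bar>\<R>\<bar>\<close> such sets.\<close>

section \<open>Reaping families\<close>

text \<open>Finitely many infinite sets all have a point in some interval starting at
  \<open>n\<close>. Iterating this cuts the numbers into consecutive intervals
  \<open>[g j, g (Suc j))\<close>, each meeting every member of \<open>\<R>\<close>. The union of
  the even-numbered ones contains infinitely many points of each member and omits infinitely
  many.\<close>

lemma finite_family_split:
  fixes \<R> :: "nat set set"
  assumes "finite \<R>" "\<And>A. A \<in> \<R> \<Longrightarrow> infinite A"
  shows "\<exists>S. \<forall>A\<in>\<R>. set_splits S A"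
proof -
  have "\<exists>m>n. \<forall>A\<in>\<R>. \<exists>a\<in>A. n \<le> a \<and> a < m" for n
    using assms
  proof (induction \<R> rule: finite_induct)
    case empty
    then show ?case by auto
  next
    case (insert A \<R>)
    then obtain m where m: "m > n" "\<forall>A\<in>\<R>. \<exists>a\<in>A. n \<le> a \<and> a < m" by auto
    have "infinite A" using insert.prems by simp
    then obtain a where a: "a \<in> A" "a \<ge> n" by (auto simp: infinite_nat_iff_unbounded_le)
    show ?case
    proof (intro exI[of _ "max m (Suc a)"] conjI ballI)
      show "n < max m (Suc a)" using m by simp
      fix B assume "B \<in> insert A \<R>"
      then consider "B = A" | "B \<in> \<R>" by blast
      then show "\<exists>x\<in>B. n \<le> x \<and> x < max m (Suc a)"
      proof cases
        case 1
        then show ?thesis using a by auto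
      next
        case 2
        then obtain x where "x \<in> B" "n \<le> x" "x < m" using m by blast
        then show ?thesis by (intro bexI[of _ x]) auto
      qed
    qed
  qed
  then obtain f where f: "\<And>n. f n > n" "\<And>n A. A \<in> \<R> \<Longrightarrow> \<exists>a\<in>A. n \<le> a \<and> a < f n" by metis
  define g where "g j = (f ^^ j) 0" for j
  have g_Suc: "g (Suc j) = f (g j)" for j by (simp add: g_def)
  have mono: "strict_mono g" by (simp add: strict_mono_Suc_iff g_Suc f)
  then have ge: "j \<le> g j" for j by (rule strict_mono_imp_increasing)
  define S where "S = {x. \<exists>j. g (2 * j) \<le> x \<and> x < g (Suc (2 * j))}"
  have notS: "x \<notin> S" if x: "g (Suc (2 * j)) \<le> x" "x < g (Suc (Suc (2 * j)))" for x j
  proof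
    assume "x \<in> S"
    then obtain i where i: "g (2 * i) \<le> x" "x < g (Suc (2 * i))" by (auto simp: S_def)
    \<comment> \<open>The first bound says \<open>j < i\<close>, the second
      \<open>i \<le> j\<close>.\<close>
    have "Suc (2 * j) < Suc (2 * i)" "2 * i < Suc (Suc (2 * j))"
      using x i mono by (meson le_less_trans strict_mono_less)+
    then show False by presburger
  qed
  have "set_splits S A" if A: "A \<in> \<R>" for A
    unfolding set_splits_def infinite_nat_iff_unbounded_le
  proof (intro conjI allI)
    fix n
    obtain a where "a \<in> A" "g (2 * n) \<le> a" "a < g (Suc (2 * n))"
      using f(2)[OF A, of "g (2 * n)"] by (auto simp: g_Suc)
    moreover have "n \<le> g (2 * n)" using ge[of "2 * n"] by simp
    ultimately show "\<exists>a\<ge>n. a \<in> A \<inter> S" by (intro exI[of _ a]) (auto simp: S_def)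
  next
    fix n
    obtain a where a: "a \<in> A" "g (Suc (2 * n)) \<le> a" "a < g (Suc (Suc (2 * n)))"
      using f(2)[OF A, of "g (Suc (2 * n))"] by (auto simp: g_Suc)
    moreover have "n \<le> g (Suc (2 * n))" using ge[of "Suc (2 * n)"] by simp
    ultimately show "\<exists>a\<ge>n. a \<in> A - S" using notS[OF a(2,3)] by (intro exI[of _ a]) auto
  qed
  then show ?thesis by blast
qed

lemma reaping_infinite: "reaping \<R> \<Longrightarrow> infinite \<R>"
  using finite_family_split unfolding reaping_def by blast

section \<open>Infinite partitions\<close>

lemma partition_on_block_eq:
  assumes "partition_on UNIV X" "b \<in> X" "c \<in> X" "n \<in> b" "n \<in> c"
  shows "b = c"
  using assms unfolding partition_on_def disjoint_def by blast

lemma partition_on_ex_block: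
  assumes "partition_on UNIV X"
  shows "\<exists>b\<in>X. n \<in> b"
  using assms unfolding partition_on_def by blast

lemma partition_on_singletons: "partition_on UNIV (range (\<lambda>n. {n}))"
  by (auto simp: partition_on_def disjoint_def)

lemma finite_blocks_meeting:
  assumes "partition_on UNIV X" "finite F"
  shows "finite {b\<in>X. b \<inter> F \<noteq> {}}"
proof -
  have "finite {b\<in>X. n \<in> b}" for n
  proof -
    obtain b where b: "b \<in> X" "n \<in> b" using partition_on_ex_block[OF assms(1)] by blast
    then have "{b\<in>X. n \<in> b} \<subseteq> {b}" using partition_on_block_eq[OF assms(1)] by blast
    then show ?thesis using finite_subset by blast
  qed
  then have "finite (\<Union>n\<in>F. {b\<in>X. n \<in> b})" using assms(2) by blast
  then show ?thesis by (rule rev_finite_subset) blast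
qed

text \<open>Take \<open>S\<close> to be the union of the even-numbered blocks in an injective
  sequence of blocks. If \<open>S\<close> does not split \<open>A\<close>, then up to a finite set
  \<open>A\<close> avoids either all even-numbered blocks or all odd-numbered ones, the latter being
  disjoint from \<open>S\<close>.\<close>

lemma unsplit_misses_blocks:
  assumes X: "X \<in> inf_parts"
  shows "\<exists>S. \<forall>A. \<not> set_splits S A \<longrightarrow> infinite {b\<in>X. b \<inter> A = {}}"
proof -
  have part: "partition_on UNIV X" and "infinite X" using X by (auto simp: inf_parts_def)
  then obtain f :: "nat \<Rightarrow> nat set" where f: "inj f" "range f \<subseteq> X"
    using infinite_countable_subset by blast
  define S where "S = (\<Union>n. f (2 * n))"
  have inf: "infinite (range (\<lambda>n. f (h n)))" if "inj h" for h :: "nat \<Rightarrow> nat"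
    using range_inj_infinite[OF inj_compose[OF f(1) that]] by (simp add: comp_def)
  \<comment> \<open>The finite error \<open>F\<close> meets only finitely many blocks, so all other
    members of \<open>Q\<close> are disjoint from \<open>A\<close>.\<close>
  have miss: "infinite {b\<in>X. b \<inter> A = {}}"
    if Q: "infinite Q" "Q \<subseteq> X" and F: "finite F" "\<And>b. b \<in> Q \<Longrightarrow> b \<inter> A \<subseteq> F" for Q A F
  proof -
    have "infinite (Q - {b\<in>X. b \<inter> F \<noteq> {}})"
      using Q finite_blocks_meeting[OF part F(1)] by simp
    moreover have "Q - {b\<in>X. b \<inter> F \<noteq> {}} \<subseteq> {b\<in>X. b \<inter> A = {}}"
      using Q F by blast
    ultimately show ?thesis using finite_subset by blast
  qed
  have odd: "f (Suc (2 * n)) \<inter> S = {}" for n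
  proof (rule ccontr)
    assume "f (Suc (2 * n)) \<inter> S \<noteq> {}"
    then obtain x m where x: "x \<in> f (Suc (2 * n))" "x \<in> f (2 * m)" by (auto simp: S_def)
    have "f (Suc (2 * n)) = f (2 * m)"
      using partition_on_block_eq[OF part _ _ x] f(2) by blast
    then have "Suc (2 * n) = 2 * m" using f(1) by (simp add: inj_eq)
    then show False by presburger
  qed
  show ?thesis
  proof (intro exI[of _ S] allI impI)
    fix A assume "\<not> set_splits S A"
    then consider "finite (A \<inter> S)" | "finite (A - S)" by (auto simp: set_splits_def)
    then show "infinite {b\<in>X. b \<inter> A = {}}"
    proof cases
      case 1
      show ?thesis
        by (rule miss[OF inf[of "\<lambda>n. 2 * n"] _ 1]) (use f(2) in \<open>auto simp: inj_def S_def\<close>)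
    next
      case 2
      show ?thesis
        by (rule miss[OF inf[of "\<lambda>n. Suc (2 * n)"] _ 2])
          (use f(2) odd in \<open>auto simp: inj_def\<close>)
    qed
  qed
qed

section \<open>Merging blocks of a partition\<close>

definition merge :: "part \<Rightarrow> part \<Rightarrow> part" where
  "merge X C = insert (\<Union>C) (X - C)"

text \<open>This serves for \<open>block_part A\<close>, a merge of singletons, and for both
  coarsenings of \<open>X\<close> that show that \<open>block_part A\<close> splits
  \<open>X\<close>. A nonempty \<open>C\<close> keeps the new block nonempty.\<close>

lemma partition_on_merge:
  assumes X: "partition_on UNIV X" and C: "C \<subseteq> X" "C \<noteq> {}"
  shows "partition_on UNIV (merge X C)"
proof -
  have X': "\<Union>X = UNIV" "disjoint X" "{} \<notin> X" using X by (auto simp: partition_on_def)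
  have "\<Union>(merge X C) = \<Union>(C \<union> (X - C))"
    unfolding merge_def Union_insert Union_Un_distrib ..
  also have "C \<union> (X - C) = X" using C(1) by blast
  finally have "\<Union>(merge X C) = UNIV" using X' by simp
  moreover have "disjoint (merge X C)"
  proof -
    have C': "d \<inter> \<Union>C = {}" if "d \<in> X - C" for d
    proof -
      have "d \<inter> c = {}" if "c \<in> C" for c
        using disjointD[OF X'(2), of d c] that \<open>d \<in> X - C\<close> C(1) by blast
      then show ?thesis by blast
    qed
    show ?thesis
    proof (rule disjointI)
      fix d e assume "d \<in> merge X C" "e \<in> merge X C" "d \<noteq> e"
      then consider "d = \<Union>C" "e \<in> X - C" | "e = \<Union>C" "d \<in> X - C" | "d \<in> X" "e \<in> X"
        unfolding merge_def by blast
      then show "d \<inter> e = {}"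
        using C'[of d] C'[of e] disjointD[OF X'(2) _ _ \<open>d \<noteq> e\<close>] by cases (simp_all add: Int_commute)
    qed
  qed
  moreover have "{} \<notin> merge X C"
  proof -
    obtain c where c: "c \<in> C" "c \<in> X" using C by blast
    then have "c \<noteq> {}" using X'(3) by metis
    then have "\<Union>C \<noteq> {}" using c(1) by blast
    then show ?thesis using X'(3) unfolding merge_def by simp
  qed
  ultimately show ?thesis by (simp add: partition_on_def)
qed

lemma merge_coarser:
  assumes "C \<subseteq> X"
  shows "merge X C \<sqsubseteq> X"
  unfolding coarser_def
proof
  fix b assume "b \<in> merge X C"
  then have "b = \<Union>C \<or> b \<in> X \<and> b = \<Union>{b}" by (auto simp: merge_def)
  then show "\<exists>B\<subseteq>X. b = \<Union>B" using assms by (metis empty_subsetI insert_subset)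
qed

lemma infinite_merge: "infinite (X - C) \<Longrightarrow> infinite (merge X C)"
  by (simp add: merge_def)

text \<open>Each block of \<open>X\<close> is the union of a subset of \<open>Y\<close>, and a
  finite \<open>Y\<close> has only finitely many subsets.\<close>

lemma coarser_infinite:
  assumes "infinite X" "X \<sqsubseteq> Y"
  shows "infinite Y"
proof
  assume "finite Y"
  then have "finite (Union ` Pow Y)" by simp
  moreover have "X \<subseteq> Union ` Pow Y" using assms(2) by (auto simp: coarser_def)
  ultimately show False using assms(1) finite_subset by blast
qed

section \<open>Partitions with one distinguished block\<close>

definition block_part :: "nat set \<Rightarrow> part" where
  "block_part A = merge (range (\<lambda>n. {n})) ((\<lambda>n. {n}) ` A)"

lemma block_part_eq: "block_part A = insert A ((\<lambda>n. {n}) ` (- A))"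
  unfolding block_part_def merge_def by auto

text \<open>For empty \<open>A\<close> the family \<open>block_part A\<close> would have an empty
  member.\<close>

lemma partition_on_block_part: "A \<noteq> {} \<Longrightarrow> partition_on UNIV (block_part A)"
  unfolding block_part_def by (intro partition_on_merge partition_on_singletons) auto

lemma infinite_block_part: "infinite (- A) \<Longrightarrow> infinite (block_part A)"
  by (simp add: block_part_eq finite_image_iff inj_on_def)

text \<open>Compatibility: merging all blocks that meet \<open>A\<close> gives \<open>Z\<close>,
  coarser than both partitions and infinite because of the missed blocks. Orthogonality: merging all
  missed blocks with one block that meets \<open>A\<close> gives \<open>Y\<close>, all of whose
  blocks meet \<open>A\<close>, so the block \<open>A\<close> ties them together. The unmerged
  blocks that meet \<open>A\<close> keep \<open>Y\<close> infinite.\<close>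

lemma splits_block_part:
  assumes X: "partition_on UNIV X"
    and meet: "infinite {b\<in>X. b \<inter> A \<noteq> {}}" and miss: "infinite {b\<in>X. b \<inter> A = {}}"
  shows "splits (block_part A) X"
proof -
  define C where "C = {b\<in>X. b \<inter> A \<noteq> {}}"
  have C: "C \<subseteq> X" "C \<noteq> {}"
    using infinite_imp_nonempty[OF meet] by (simp_all add: C_def)
  then obtain c where c: "c \<in> C" by blast
  \<comment> \<open>The extra block \<open>c\<close> supplies the merged block with a point of
    \<open>A\<close>; removing it from \<open>C\<close> leaves infinitely many blocks.\<close>
  define D where "D = insert c (X - C)"
  have D: "D \<subseteq> X" "D \<noteq> {}" using C c by (auto simp: D_def)
  have A: "A \<noteq> {}" using c by (auto simp: C_def)
  note W = partition_on_block_part[OF A]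
  have "X - C = {b\<in>X. b \<inter> A = {}}" by (auto simp: C_def)
  then have infC: "infinite (X - C)" using miss by simp
  have "X - D = C - {c}" using C by (auto simp: D_def)
  then have infD: "infinite (X - D)" using meet by (simp add: C_def)
  define Z where "Z = merge X C"
  have Z: "partition_on UNIV Z" unfolding Z_def by (rule partition_on_merge[OF X C])
  have "Z \<sqsubseteq> block_part A" unfolding coarser_iff[OF W Z]
  proof
    fix w assume "w \<in> block_part A"
    then consider "w = A" | n where "w = {n}" by (auto simp: block_part_eq)
    then show "\<exists>z\<in>Z. w \<subseteq> z"
    proof cases
      case 1
      have "A \<subseteq> \<Union>C"
        unfolding C_def using partition_on_ex_block[OF X] by fast
      then show ?thesis using 1 by (auto simp: Z_def merge_def)
    next
      case 2
      obtain z where "z \<in> Z" "n \<in> z" using partition_on_ex_block[OF Z] by blast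
      then show ?thesis using 2 by blast
    qed
  qed
  moreover have "Z \<sqsubseteq> X" unfolding Z_def by (rule merge_coarser[OF C(1)])
  moreover note J = pjoin_is_finest[OF W X]
  ultimately have "Z \<sqsubseteq> block_part A \<squnion> X" using Z by (simp add: is_finest_def)
  moreover have "infinite Z" unfolding Z_def by (rule infinite_merge[OF infC])
  ultimately have "infinite (block_part A \<squnion> X)" using coarser_infinite by blast
  then have compat: "compatible (block_part A) X"
    using J by (simp add: compatible_def inf_parts_def is_finest_def)
  define Y where "Y = merge X D"
  have Y: "partition_on UNIV Y" unfolding Y_def by (rule partition_on_merge[OF X D])
  have Y_meets: "y \<inter> A \<noteq> {}" if "y \<in> Y" for y
    using that c by (auto simp: Y_def merge_def D_def C_def)
  define J where "J = block_part A \<squnion> Y"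
  have J: "partition_on UNIV J" "J \<sqsubseteq> block_part A" "J \<sqsubseteq> Y"
    using pjoin_is_finest[OF W Y] by (simp_all add: is_finest_def J_def)
  obtain d where d: "d \<in> J" "A \<subseteq> d"
    using J(2) unfolding coarser_iff[OF W J(1)] by (auto simp: block_part_eq)
  have "n \<in> d" for n
  proof -
    obtain y where y: "y \<in> Y" "n \<in> y" using partition_on_ex_block[OF Y] by blast
    then obtain e where e: "e \<in> J" "y \<subseteq> e" using J(3) unfolding coarser_iff[OF Y J(1)] by blast
    obtain m where "m \<in> y" "m \<in> A" using Y_meets[OF y(1)] by blast
    then have "e = d" using partition_on_block_eq[OF J(1) e(1) d(1)] e d by blast
    then show ?thesis using y e by blast
  qed
  then have "d = UNIV" by blast
  then have "UNIV \<in> J" using d(1) by simp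
  moreover have "e = UNIV" if "e \<in> J" for e
  proof -
    have "e \<noteq> {}" using J(1) that by (auto simp: partition_on_def)
    then show ?thesis using partition_on_block_eq[OF J(1) that \<open>UNIV \<in> J\<close>] by blast
  qed
  ultimately have "J = {UNIV}" by blast
  moreover have "Y \<in> inf_parts"
    using Y infinite_merge[OF infD] by (simp add: inf_parts_def Y_def)
  moreover have "Y \<sqsubseteq> X" unfolding Y_def by (rule merge_coarser[OF D(1)])
  ultimately show ?thesis using compat by (auto simp: splits_def orthogonal_def J_def)
qed

section \<open>The partition \<open>X\<^sup>\<bottom>\<close>\<close>

text \<open>The number of predecessors in \<open>b\<close> grows strictly along
  \<open>b\<close>.\<close>

lemma is_nth_elem_unique:
  assumes "is_nth_elem i b m" "is_nth_elem i b n"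
  shows "m = n"
proof -
  have *: "\<not> m < n" if m: "is_nth_elem i b m" and n: "is_nth_elem i b n" for m n
  proof
    assume "m < n"
    then have "{k\<in>b. k < m} \<subset> {k\<in>b. k < n}" using m by (auto simp: is_nth_elem_def)
    then have "card {k\<in>b. k < m} < card {k\<in>b. k < n}" by (intro psubset_card_mono) auto
    then show False using m n by (simp add: is_nth_elem_def)
  qed
  show ?thesis using *[of m n] *[of n m] assms by simp
qed

lemma ex_is_nth_elem:
  assumes "infinite b"
  shows "\<exists>n. is_nth_elem i b n"
proof (induction i)
  case 0
  have "b \<noteq> {}" using assms by auto
  then have "(LEAST n. n \<in> b) \<in> b" by (auto intro: LeastI)
  moreover have "{m\<in>b. m < (LEAST n. n \<in> b)} = {}" using not_less_Least by auto
  ultimately have "is_nth_elem 0 b (LEAST n. n \<in> b)" unfolding is_nth_elem_def by simp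
  then show ?case ..
next
  case (Suc i)
  then obtain n where n: "n \<in> b" "card {m\<in>b. m < n} = i" by (auto simp: is_nth_elem_def)
  let ?k = "LEAST k. k \<in> b \<and> n < k"
  have "\<exists>k. k \<in> b \<and> n < k" using assms by (auto simp: infinite_nat_iff_unbounded)
  then have k: "?k \<in> b \<and> n < ?k" by (rule LeastI_ex)
  have "{m\<in>b. m < ?k} = insert n {m\<in>b. m < n}"
    using n k not_less_Least[of _ "\<lambda>k. k \<in> b \<and> n < k"] by (auto simp: not_less_iff_gr_or_eq)
  then have "is_nth_elem (Suc i) b ?k" using n k by (simp add: is_nth_elem_def)
  then show ?case ..
qed

text \<open>An element has a single position, in the only block containing it, so the rows are
  disjoint. A block has at most one \<open>i\<close>-th element, so it meets each row in at most one
  point.\<close>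

lemma perp_inf_block:
  assumes X: "X \<in> inf_block_parts"
  shows "perp X \<in> inf_parts" and "b \<in> X \<Longrightarrow> c \<in> perp X \<Longrightarrow> finite (b \<inter> c)"
proof -
  have part: "partition_on UNIV X" using X by (simp add: inf_block_parts_def inf_parts_def)
  define row where "row i = {n. \<exists>b\<in>X. is_nth_elem i b n}" for i
  have perp: "perp X = range row" using X by (simp add: perp_def row_def)
  \<comment> \<open>An infinite block of \<open>X\<close> has an \<open>i\<close>-th element for
    every \<open>i\<close>.\<close>
  have ne: "row i \<noteq> {}" for i
    using X ex_is_nth_elem by (fastforce simp: inf_block_parts_def row_def)
  have eq: "i = j" if ij: "n \<in> row i" "n \<in> row j" for n i j
  proof -
    obtain b c where bc: "b \<in> X" "is_nth_elem i b n" "c \<in> X" "is_nth_elem j c n"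
      using ij by (auto simp: row_def)
    then have "b = c" using partition_on_block_eq[OF part] by (auto simp: is_nth_elem_def)
    then show ?thesis using bc by (simp add: is_nth_elem_def)
  qed
  have "n \<in> \<Union>(range row)" for n
  proof -
    obtain b where "b \<in> X" "n \<in> b" using partition_on_ex_block[OF part] by blast
    then have "n \<in> row (card {m\<in>b. m < n})" by (auto simp: row_def is_nth_elem_def)
    then show ?thesis by blast
  qed
  then have "\<Union>(range row) = UNIV" by blast
  moreover have "disjoint (range row)" using eq unfolding disjoint_def by blast
  moreover have "{} \<notin> range row" using ne by fastforce
  moreover have "inj row"
  proof (rule injI)
    fix i j assume "row i = row j"
    moreover obtain n where "n \<in> row i" using ne[of i] by blast
    ultimately show "i = j" using eq[of n i j] by simp
  qed
  ultimately show "perp X \<in> inf_parts"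
    by (simp add: perp inf_parts_def partition_on_def range_inj_infinite)
  assume b: "b \<in> X" and "c \<in> perp X"
  then obtain i where c: "c = row i" by (auto simp: perp)
  have "is_nth_elem i b n" if n: "n \<in> b \<inter> c" for n
  proof -
    obtain b' where b': "b' \<in> X" "is_nth_elem i b' n" using n by (auto simp: c row_def)
    then have "b' = b"
      using partition_on_block_eq[OF part _ b] n by (auto simp: is_nth_elem_def)
    then show ?thesis using b' by simp
  qed
  then have "m = n" if "m \<in> b \<inter> c" "n \<in> b \<inter> c" for m n
    using that is_nth_elem_unique by blast
  then show "finite (b \<inter> c)" by (metis finite.simps finite_subset insertI1 subsetI)
qed

text \<open>Only finitely many blocks contain a point that is not the least of its block; all others
  are singletons. Gluing the finite union of the exceptional blocks in the singleton partition
  yields a partition coarser than \<open>X\<close>. The contrapositive gives \<open>perp X\<close>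
  infinitely many singleton blocks.\<close>

lemma trivial_part_if_finite:
  assumes X: "partition_on UNIV X" and fin: "\<And>b. b \<in> X \<Longrightarrow> finite b"
    and M: "finite (- ((\<lambda>b. LEAST n. n \<in> b) ` X))" (is "finite (- ?M)")
  shows "trivial_part X"
proof -
  let ?S = "range (\<lambda>n::nat. {n})"
  note S = partition_on_singletons
  \<comment> \<open>Every partition is coarser than the singletons, so nothing has to be glued
    here.\<close>
  have "glue X {} \<sqsubseteq> ?S"
  proof -
    have Z: "partition_on UNIV (glue X {})" using glue_is_finest[OF X] by (simp add: is_finest_def)
    show ?thesis unfolding coarser_iff[OF S Z] using partition_on_ex_block[OF Z] by auto
  qed
  then have "X \<sqsubseteq>\<^sup>* ?S" unfolding almost_coarser_def by blast
  moreover have "?S \<sqsubseteq>\<^sup>* X"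
  proof -
    define f where "f = \<Union>{b\<in>X. b \<inter> - ?M \<noteq> {}}"
    have "finite f" unfolding f_def using finite_blocks_meeting[OF X M] fin by blast
    moreover have "glue ?S f \<sqsubseteq> X"
    proof -
      have Z: "partition_on UNIV (glue ?S f)" and ex: "\<exists>c\<in>glue ?S f. f \<subseteq> c"
        using glue_is_finest[OF S, of f] by (auto simp: is_finest_def)
      show ?thesis unfolding coarser_iff[OF X Z]
      proof
        fix b assume b: "b \<in> X"
        show "\<exists>c\<in>glue ?S f. b \<subseteq> c"
        proof (cases "b \<subseteq> ?M")
          case False
          then have "b \<subseteq> f" using b by (auto simp: f_def)
          then show ?thesis using ex by blast
        next
          case True
          \<comment> \<open>A point of \<open>?M\<close> is the least element of the block
            containing it, so a block inside \<open>?M\<close> has only one point.\<close>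
          have "n = (LEAST n. n \<in> b)" if n: "n \<in> b" for n
          proof -
            obtain b' where b': "b' \<in> X" "n = (LEAST n. n \<in> b')" using True n by blast
            have "b' \<noteq> {}" using X b'(1) by (auto simp: partition_on_def)
            then have "\<exists>m. m \<in> b'" by blast
            then have "n \<in> b'" unfolding b'(2) by (rule LeastI_ex)
            then have "b' = b" using partition_on_block_eq[OF X b'(1) b] n by blast
            then show ?thesis using b' by simp
          qed
          then have "b \<subseteq> {LEAST n. n \<in> b}" by blast
          then show ?thesis
            using partition_on_ex_block[OF Z, of "LEAST n. n \<in> b"] by blast
        qed
      qed
    qed
    ultimately show ?thesis unfolding almost_coarser_def by blast
  qed
  ultimately show ?thesis by (simp add: trivial_part_def almost_eq_def)
qed

text \<open>Non-triviality makes the complement of the set of least elements infinite, which gives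
  infinitely many singletons in \<open>perp X\<close>. Finiteness of the blocks of \<open>X\<close>
  yields their finite intersections with blocks of \<open>perp X\<close>.\<close>

lemma perp_finite_blocks:
  assumes X: "X \<in> inf_parts" "X \<notin> inf_block_parts" and nontriv: "\<not> trivial_part X"
  shows "perp X \<in> inf_parts" and "b \<in> X \<Longrightarrow> finite b"
proof -
  have part: "partition_on UNIV X" "infinite X" using X(1) by (simp_all add: inf_parts_def)
  have fin: "finite b" if "b \<in> X" for b using that X by (auto simp: inf_block_parts_def)
  then show "b \<in> X \<Longrightarrow> finite b" .
  define M where "M = (\<lambda>b. LEAST n. n \<in> b) ` X"
  have "perp X = block_part M"
    using X(2) by (simp add: perp_def M_def block_part_eq Let_def)
  moreover have "infinite (- M)"
    using trivial_part_if_finite[OF part(1) fin] nontriv unfolding M_def by blast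
  moreover have "M \<noteq> {}" using part(2) by (auto simp: M_def)
  ultimately show "perp X \<in> inf_parts"
    by (simp add: inf_parts_def infinite_block_part partition_on_block_part)
qed

section \<open>The weak splitting family\<close>

text \<open>Otherwise \<open>A\<close> would be covered by finitely many of the finite sets
  \<open>b \<inter> c\<close>.\<close>

lemma infinite_set_meets_blocks:
  assumes X: "partition_on UNIV X" and Y: "partition_on UNIV Y"
    and fin: "\<And>b c. b \<in> X \<Longrightarrow> c \<in> Y \<Longrightarrow> finite (b \<inter> c)" and A: "infinite A"
  shows "infinite {b\<in>X. b \<inter> A \<noteq> {}} \<or> infinite {c\<in>Y. c \<inter> A \<noteq> {}}"
proof (rule ccontr)
  assume *: "\<not> ?thesis"
  have "finite (\<Union>b\<in>{b\<in>X. b \<inter> A \<noteq> {}}. \<Union>c\<in>{c\<in>Y. c \<inter> A \<noteq> {}}. b \<inter> c)"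
    using * fin by blast
  moreover have "A \<subseteq> (\<Union>b\<in>{b\<in>X. b \<inter> A \<noteq> {}}. \<Union>c\<in>{c\<in>Y. c \<inter> A \<noteq> {}}. b \<inter> c)"
    using X Y unfolding partition_on_def by blast
  ultimately show False using A finite_subset by blast
qed

lemma reaping_split_two_parts:
  assumes \<R>: "reaping \<R>" and X: "X \<in> inf_parts" and Y: "Y \<in> inf_parts"
    and fin: "\<And>b c. b \<in> X \<Longrightarrow> c \<in> Y \<Longrightarrow> finite (b \<inter> c)"
  obtains A B where "A \<in> \<R>" "B \<in> \<R>" "block_part (enumerate A ` B) \<in> inf_block_parts"
    "splits (block_part (enumerate A ` B)) X \<or> splits (block_part (enumerate A ` B)) Y"
proof -
  have part: "partition_on UNIV X" "partition_on UNIV Y" using X Y by (simp_all add: inf_parts_def)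
  obtain S where S: "\<And>A. \<not> set_splits S A \<Longrightarrow> infinite {b\<in>X. b \<inter> A = {}}"
    using unsplit_misses_blocks[OF X] by blast
  obtain T where T: "\<And>A. \<not> set_splits T A \<Longrightarrow> infinite {c\<in>Y. c \<inter> A = {}}"
    using unsplit_misses_blocks[OF Y] by blast
  obtain A where A: "A \<in> \<R>" "infinite A" "\<not> set_splits S A"
    using \<R> by (auto simp: reaping_def)
  \<comment> \<open>Taking the preimage of \<open>T\<close> transfers the choice into
    \<open>A\<close>: if \<open>T\<close> split the image of \<open>B\<close>, its preimage would
    split \<open>B\<close>.\<close>
  obtain B where B: "B \<in> \<R>" "infinite B" "\<not> set_splits (enumerate A -` T) B"
    using \<R> by (auto simp: reaping_def)
  define D where "D = enumerate A ` B"
  have inj: "inj (enumerate A)"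
    using strict_mono_enumerate[OF A(2)] by (rule strict_mono_imp_inj_on)
  \<comment> \<open>Blocks of \<open>X\<close> missed by \<open>A\<close> are missed by every subset
    of \<open>A\<close>, so shrinking \<open>A\<close> to \<open>D\<close> for the sake of
    \<open>Y\<close> does no harm to \<open>X\<close>.\<close>
  have "D \<subseteq> A" using enumerate_in_set[OF A(2)] by (auto simp: D_def)
  then have "{b\<in>X. b \<inter> A = {}} \<subseteq> {b\<in>X. b \<inter> D = {}}" by blast
  then have missX: "infinite {b\<in>X. b \<inter> D = {}}" using S[OF A(3)] finite_subset by blast
  have "D \<inter> T = enumerate A ` (B \<inter> enumerate A -` T)"
    "D - T = enumerate A ` (B - enumerate A -` T)" by (auto simp: D_def)
  then have "\<not> set_splits T D"
    using B(3) by (auto simp: set_splits_def)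
  then have missY: "infinite {c\<in>Y. c \<inter> D = {}}" by (rule T)
  have D: "infinite D" unfolding D_def
    using B(2) inj by (metis finite_imageD inj_on_subset subset_UNIV)
  \<comment> \<open>Each missed block is nonempty and hence meets the complement of
    \<open>D\<close>, while a finite complement would meet only finitely many blocks.\<close>
  have "infinite (- D)"
  proof
    assume "finite (- D)"
    then have "finite {b\<in>X. b \<inter> - D \<noteq> {}}" by (rule finite_blocks_meeting[OF part(1)])
    moreover have "{b\<in>X. b \<inter> D = {}} \<subseteq> {b\<in>X. b \<inter> - D \<noteq> {}}"
    proof clarify
      fix b assume b: "b \<in> X" "b \<inter> D = {}" "b \<inter> - D = {}"
      then have "b = {}" by blast
      then show False using b(1) partition_onD3[OF part(1)] by simp
    qed
    ultimately show False using missX finite_subset by blast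
  qed
  moreover have "D \<noteq> {}" using D by auto
  moreover have "D \<in> block_part D" by (simp add: block_part_eq)
  ultimately have "block_part D \<in> inf_block_parts"
    using D partition_on_block_part[of D] infinite_block_part[of D]
    by (auto simp: inf_block_parts_def inf_parts_def)
  moreover have "splits (block_part D) X \<or> splits (block_part D) Y"
    using infinite_set_meets_blocks[OF part fin D]
  proof
    assume "infinite {b\<in>X. b \<inter> D \<noteq> {}}"
    from splits_block_part[OF part(1) this missX] show ?thesis ..
  next
    assume "infinite {c\<in>Y. c \<inter> D \<noteq> {}}"
    from splits_block_part[OF part(2) this missY] show ?thesis ..
  qed
  ultimately show ?thesis using that[OF A(1) B(1)] unfolding D_def by simp
qed

theorem mainTheorem12: "weak_splitting_number \<le>o reaping_number"
proof -
  obtain \<R> where \<R>: "reaping \<R>" and r: "reaping_number = card_of \<R>"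
    using least_size(1)[of reaping, OF reaping_infinite_sets] by (auto simp: reaping_number_def)
  define w where "w = (\<lambda>(A, B). block_part (enumerate A ` B))"
  \<comment> \<open>For arbitrary \<open>A\<close> and \<open>B\<close> in \<open>\<R>\<close> the
    image may be cofinite, and \<open>block_part\<close> then has only finitely many blocks; the
    intersection discards such pairs.\<close>
  define \<W> where "\<W> = w ` (\<R> \<times> \<R>) \<inter> inf_block_parts"
  have "\<exists>W\<in>\<W>. splits W X \<or> splits W (perp X)" if X: "X \<in> inf_parts" "\<not> trivial_part X" for X
  proof -
    have "perp X \<in> inf_parts" and "\<And>b c. b \<in> X \<Longrightarrow> c \<in> perp X \<Longrightarrow> finite (b \<inter> c)"
      using perp_inf_block[of X] perp_finite_blocks[OF X(1) _ X(2)] by blast+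
    then obtain A B where AB: "A \<in> \<R>" "B \<in> \<R>" "block_part (enumerate A ` B) \<in> inf_block_parts"
      "splits (block_part (enumerate A ` B)) X \<or> splits (block_part (enumerate A ` B)) (perp X)"
      using reaping_split_two_parts[OF \<R> X(1)] by blast
    then have "w (A, B) \<in> \<W>" by (auto simp: \<W>_def w_def)
    moreover have "splits (w (A, B)) X \<or> splits (w (A, B)) (perp X)" using AB by (simp add: w_def)
    ultimately show ?thesis by blast
  qed
  then have "weak_splitting \<W>" by (auto simp: weak_splitting_def \<W>_def)
  then have "weak_splitting_number \<le>o card_of \<W>"
    unfolding weak_splitting_number_def using least_size(2) by blast
  also have "card_of \<W> \<le>o card_of (w ` (\<R> \<times> \<R>))" unfolding \<W>_def by (intro card_of_mono1) blast
  also have "card_of (w ` (\<R> \<times> \<R>)) \<le>o card_of (\<R> \<times> \<R>)" by (rule card_of_image)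
  also have "card_of (\<R> \<times> \<R>) =o card_of \<R>"
    using reaping_infinite[OF \<R>] by (rule card_of_Times_same_infinite)
  finally show ?thesis unfolding r .
qed

end
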